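(* Let $m,n,q\ge 1$ be integers and let $G$ be a simple graph with at least one edge on the vertex set $\{v_{i,j,k} : 1\le i\le m,\ 1\le j\le n,\ 1\le k\le q\}$. Let $G'$ be the graph theoretical partial transpose (GTPT) of $G$. Suppose that $G$ is degree symmetric, i.e. $d_G(u)=d_{G'}(u)$ for every vertex $u$. Then: (a) if $\rho_l(G)$ is fully separable in $\mathbb{C}^m\otimes\mathbb{C}^n\otimes\mathbb{C}^q$, then $\rho_l(G')$ is fully separable in $\mathbb{C}^m\otimes\mathbb{C}^n\otimes\mathbb{C}^q$; (b) if $\rho_q(G)$ is fully separable in $\mathbb{C}^m\otimes\mathbb{C}^n\otimes\mathbb{C}^q$, then $\rho_q(G')$ is fully separable in $\mathbb{C}^m\otimes\mathbb{C}^n\otimes\mathbb{C}^q$.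
   Context: Graphs are finite, undirected and simple (no loops, no multiple edges); an edge $(a,b)$ is the same as $(b,a)$. $d_G(u)$ is the degree of the vertex $u$ in $G$, $D(G)$ is the diagonal degree matrix, and $A(G)$ is the $0/1$ adjacency matrix. Put $L(G)=D(G)-A(G)$ and $Q(G)=D(G)+A(G)$, and define the density matrices of $G$ (for $G$ with at least one edge) by $$\rho_l(G)=\frac{L(G)}{\mathrm{tr}(L(G))},\qquad \rho_q(G)=\frac{Q(G)}{\mathrm{tr}(Q(G))}.$$ The vertex $v_{i,j,k}$ is identified with the integer $nq(i-1)+q(j-1)+k\in\{1,\dots,mnq\}$, so that the matrices above are $mnq\times mnq$ matrices acting on $\mathbb{C}^m\otimes\mathbb{C}^n\otimes\mathbb{C}^q$, with $v_{i,j,k}$ corresponding to the basis vector $e_i\otimes e_j\otimes e_k$. GTPT: $G'$ is the simple graph on the same vertex set (same labelling) obtained from $G$ by replacing every edge $(v_{i,j,k},v_{s,u,v})$ of $G$ with $i\ne s$ by $(v_{s,j,k},v_{i,u,v})$ (all simultaneously), and keeping all other edges unchanged. A density matrix is a positive semidefinite Hermitian matrix of trace $1$. A density matrix $\rho$ on $H_1\otimes H_2\otimes H_3$ is fully separable if $\rho=\sum_i p_i\,\rho_i^1\otimes\rho_i^2\otimes\rho_i^3$ (finite sum) with $p_i\ge 0$, $\sum_i p_i=1$, and each $\rho_i^j$ a density matrix on $H_j$. *)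

theory Defs
  imports
    "Graph_Theory.Pair_Digraph"
    "Jordan_Normal_Form.Schur_Decomposition"
begin

text \<open>
  A finite simple undirected graph is a \<^locale>\<open>pair_graph\<close>: a finite, loop-free digraph without
  parallel arcs whose arc set is symmetric, so that the undirected edge between \<open>a\<close> and \<open>b\<close> is the
  pair of arcs \<open>(a, b)\<close> and \<open>(b, a)\<close>. By symmetry the out-degree is the degree.
\<close>

abbreviation degree_of :: "nat pair_pre_digraph \<Rightarrow> nat \<Rightarrow> nat" where
  "degree_of G u \<equiv> out_degree (with_proj G) u"

text \<open>
  The matrices below are meant for graphs with vertex set \<open>{1..N}\<close>. Matrix indices start at \<open>0\<close>,
  so the row or column with index \<open>r\<close> belongs to the vertex \<open>r + 1\<close>.
\<close>

definition degree_matrix :: "nat pair_pre_digraph \<Rightarrow> complex mat" where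
  "degree_matrix G = mat (card (pverts G)) (card (pverts G))
     (\<lambda>(r, c). if r = c then of_nat (degree_of G (r + 1)) else 0)"

definition adjacency_matrix :: "nat pair_pre_digraph \<Rightarrow> complex mat" where
  "adjacency_matrix G = mat (card (pverts G)) (card (pverts G))
     (\<lambda>(r, c). if (r + 1, c + 1) \<in> parcs G then 1 else 0)"

definition laplacian :: "nat pair_pre_digraph \<Rightarrow> complex mat" where
  "laplacian G = degree_matrix G - adjacency_matrix G"

definition signless_laplacian :: "nat pair_pre_digraph \<Rightarrow> complex mat" where
  "signless_laplacian G = degree_matrix G + adjacency_matrix G"

definition mat_trace :: "'a::comm_monoid_add mat \<Rightarrow> 'a" where
  "mat_trace A = (\<Sum>i<dim_row A. A $$ (i, i))"

definition rho_l :: "nat pair_pre_digraph \<Rightarrow> complex mat" where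
  "rho_l G = (1 / mat_trace (laplacian G)) \<cdot>\<^sub>m laplacian G"

definition rho_q :: "nat pair_pre_digraph \<Rightarrow> complex mat" where
  "rho_q G = (1 / mat_trace (signless_laplacian G)) \<cdot>\<^sub>m signless_laplacian G"

text \<open>The vertex $v_{i,j,k}$, for \<open>i\<close>, \<open>j\<close>, \<open>k\<close> starting at \<open>1\<close>.\<close>

definition vertex :: "nat \<Rightarrow> nat \<Rightarrow> nat \<Rightarrow> nat \<Rightarrow> nat \<Rightarrow> nat" where
  "vertex n q i j k = n * q * (i - 1) + q * (j - 1) + k"

definition tripartite_vertices :: "nat \<Rightarrow> nat \<Rightarrow> nat \<Rightarrow> nat set" where
  "tripartite_vertices m n q =
     {vertex n q i j k | i j k. i \<in> {1..m} \<and> j \<in> {1..n} \<and> k \<in> {1..q}}"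

text \<open>
  The graph theoretical partial transpose. The range restrictions on the indices are needed:
  \<^const>\<open>vertex\<close> is injective only on index triples within these ranges.
\<close>

definition gtpt :: "nat \<Rightarrow> nat \<Rightarrow> nat \<Rightarrow> nat pair_pre_digraph \<Rightarrow> nat pair_pre_digraph" where
  "gtpt m n q G = \<lparr>
     pverts = pverts G,
     parcs =
       {(vertex n q i j k, vertex n q s u v) | i j k s u v.
          i \<in> {1..m} \<and> j \<in> {1..n} \<and> k \<in> {1..q} \<and> s \<in> {1..m} \<and> u \<in> {1..n} \<and> v \<in> {1..q} \<and>
          i = s \<and> (vertex n q i j k, vertex n q s u v) \<in> parcs G}
       \<union>
       {(vertex n q s j k, vertex n q i u v) | i j k s u v.
          i \<in> {1..m} \<and> j \<in> {1..n} \<and> k \<in> {1..q} \<and> s \<in> {1..m} \<and> u \<in> {1..n} \<and> v \<in> {1..q} \<and>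
          i \<noteq> s \<and> (vertex n q i j k, vertex n q s u v) \<in> parcs G}\<rparr>"

definition degree_symmetric :: "nat \<Rightarrow> nat \<Rightarrow> nat \<Rightarrow> nat pair_pre_digraph \<Rightarrow> bool" where
  "degree_symmetric m n q G \<longleftrightarrow>
     (\<forall>u \<in> pverts G. degree_of G u = degree_of (gtpt m n q G) u)"

text \<open>
  On complex numbers \<open>0 \<le> z\<close> means that \<open>z\<close> is real and nonnegative, and \<open>(A *\<^sub>v x) \<bullet>c x\<close> is the
  form $x^{*} A x$.
\<close>

definition density_matrix :: "nat \<Rightarrow> complex mat \<Rightarrow> bool" where
  "density_matrix d A \<longleftrightarrow>
     A \<in> carrier_mat d d \<and>
     mat_adjoint A = A \<and>
     (\<forall>x \<in> carrier_vec d. 0 \<le> (A *\<^sub>v x) \<bullet>c x) \<and>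
     mat_trace A = 1"

text \<open>
  The Kronecker product, for which $e_i \otimes e_j$ has (0-based) index \<open>i * d + j\<close>, where \<open>d\<close> is the
  dimension of the second factor. In a threefold product with factors of dimensions \<open>m\<close>, \<open>n\<close>, \<open>q\<close>
  the basis vector $e_i \otimes e_j \otimes e_k$ (1-based) therefore has 0-based index
  \<open>vertex n q i j k - 1\<close>.
\<close>

definition kronecker :: "complex mat \<Rightarrow> complex mat \<Rightarrow> complex mat" (infixl \<open>\<otimes>\<^sub>K\<close> 70) where
  "A \<otimes>\<^sub>K B = mat (dim_row A * dim_row B) (dim_col A * dim_col B)
     (\<lambda>(r, c). A $$ (r div dim_row B, c div dim_col B) * B $$ (r mod dim_row B, c mod dim_col B))"

text \<open>
  The type of matrices is not a monoid under addition, so the finite sum is taken entrywise.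
\<close>

definition fully_separable :: "nat \<Rightarrow> nat \<Rightarrow> nat \<Rightarrow> complex mat \<Rightarrow> bool" where
  "fully_separable m n q \<rho> \<longleftrightarrow>
     density_matrix (m * n * q) \<rho> \<and>
     (\<exists>(N::nat) (p :: nat \<Rightarrow> real) \<rho>1 \<rho>2 \<rho>3.
        (\<forall>i<N. 0 \<le> p i \<and> density_matrix m (\<rho>1 i) \<and> density_matrix n (\<rho>2 i) \<and>
               density_matrix q (\<rho>3 i)) \<and>
        (\<Sum>i<N. p i) = 1 \<and>
        \<rho> = mat (m * n * q) (m * n * q)
              (\<lambda>rc. \<Sum>i<N. complex_of_real (p i) * (\<rho>1 i \<otimes>\<^sub>K \<rho>2 i \<otimes>\<^sub>K \<rho>3 i) $$ rc))"

end

theory Submission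
  imports Defs
begin

text \<open>
  For a degree symmetric graph, passing from \<open>G\<close> to its GTPT replaces the (signless) Laplacian by its
  partial transpose on the first tensor factor: the adjacency matrix is partially transposed, and the
  diagonal degree matrix is unaffected. The partial transpose of $\sum_i p_i\, \rho_i^1 \otimes \rho_i^2 \otimes
  \rho_i^3$ is $\sum_i p_i\, (\rho_i^1)^T \otimes \rho_i^2 \otimes \rho_i^3$, and transposes of density matrices
  are density matrices. That the result is positive semidefinite is read off from the (signless)
  Laplacian form $\sum_{rc \in E} |x_r \mp x_c|^2$ of the GTPT.
\<close>

section \<open>Quadratic forms and density matrices\<close>

text \<open>Twice the expression is the sum over all \<open>r\<close>, \<open>c\<close> of
  \<open>a r c\<close> times the squared modulus of \<open>x r + s * x c\<close>. Symmetry of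
  \<open>a\<close> identifies the two square terms with \<open>?D\<close> and the two cross terms
  with \<open>?E\<close>.\<close>

lemma signed_quadratic_form_nonneg:
  fixes a :: "nat \<Rightarrow> nat \<Rightarrow> complex" and x :: "nat \<Rightarrow> complex"
  assumes sym: "\<And>r c. a r c = a c r" and nonneg: "\<And>r c. 0 \<le> a r c"
    and s: "s = 1 \<or> s = -1"
  shows "0 \<le> (\<Sum>r<N. (\<Sum>c<N. a r c) * x r * cnj (x r)) + s * (\<Sum>r<N. \<Sum>c<N. a r c * x c * cnj (x r))"
    (is "0 \<le> ?D + s * ?E")
proof -
  have s2: "s * s = 1" "cnj s = s" using s by auto
  have D1: "(\<Sum>r<N. \<Sum>c<N. a r c * x r * cnj (x r)) = ?D"
    by (simp add: sum_distrib_right)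
  have D2: "(\<Sum>r<N. \<Sum>c<N. a r c * x c * cnj (x c)) = ?D"
    unfolding D1[symmetric] by (subst sum.swap) (intro sum.cong refl, subst sym, simp)
  have E2: "(\<Sum>r<N. \<Sum>c<N. a r c * x r * cnj (x c)) = ?E"
    by (subst sum.swap) (intro sum.cong refl, subst sym, simp)
  have "a r c * ((x r + s * x c) * cnj (x r + s * x c))
      = a r c * x r * cnj (x r) + a r c * x c * cnj (x c)
        + s * (a r c * x c * cnj (x r)) + s * (a r c * x r * cnj (x c))" for r c
    using s by (auto simp: algebra_simps)
  then have "(\<Sum>r<N. \<Sum>c<N. a r c * ((x r + s * x c) * cnj (x r + s * x c)))
      = ?D + ?D + s * ?E + s * ?E"
    by (simp only: sum.distrib sum_distrib_left[symmetric] D1 D2 E2)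
  moreover have "0 \<le> (\<Sum>r<N. \<Sum>c<N. a r c * ((x r + s * x c) * cnj (x r + s * x c)))"
    using nonneg by (intro sum_nonneg mult_nonneg_nonneg[of "a _ _"])
      (simp_all only: complex_norm_square[symmetric], simp add: less_eq_complex_def)
  ultimately have "0 \<le> 2 * (?D + s * ?E)" by (simp add: algebra_simps)
  then show ?thesis by (simp add: less_eq_complex_def)
qed

lemma form_eq_sum:
  assumes "A \<in> carrier_mat d d" "x \<in> carrier_vec d"
  shows "(A *\<^sub>v x) \<bullet>c x = (\<Sum>r<d. (\<Sum>c<d. A $$ (r, c) * x $ c) * cnj (x $ r))"
  using assms by (auto simp: scalar_prod_def lessThan_atLeast0 conjugate_complex_def intro!: sum.cong)

lemma form_smult:
  fixes A :: "complex mat"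
  assumes "A \<in> carrier_mat d d" "x \<in> carrier_vec d"
  shows "((k \<cdot>\<^sub>m A) *\<^sub>v x) \<bullet>c x = k * ((A *\<^sub>v x) \<bullet>c x)"
  using assms by (simp add: form_eq_sum[of _ d] sum_distrib_left sum_distrib_right mult.assoc)

lemma adjoint_eq_iff:
  fixes A :: "complex mat"
  assumes "A \<in> carrier_mat d d"
  shows "mat_adjoint A = A \<longleftrightarrow> (\<forall>r<d. \<forall>c<d. cnj (A $$ (c, r)) = A $$ (r, c))"
  using assms by (auto simp: mat_adjoint_def mat_of_rows_def conjugate_complex_def mat_eq_iff)

text \<open>The form of the transpose at \<open>x\<close> is the form of \<open>A\<close> at the
  entrywise conjugate of \<open>x\<close>, which gives positivity.\<close>

lemma density_matrix_transpose:
  assumes "density_matrix d A"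
  shows "density_matrix d A\<^sup>T"
proof -
  have A: "A \<in> carrier_mat d d" using assms by (simp add: density_matrix_def)
  have "0 \<le> (A\<^sup>T *\<^sub>v x) \<bullet>c x" if x: "x \<in> carrier_vec d" for x
  proof -
    define y where "y = vec d (\<lambda>i. cnj (x $ i))"
    have y: "y \<in> carrier_vec d" by (simp add: y_def)
    have "(A\<^sup>T *\<^sub>v x) \<bullet>c x = (\<Sum>r<d. \<Sum>c<d. A $$ (c, r) * x $ c * cnj (x $ r))"
      using A x by (simp add: form_eq_sum sum_distrib_right)
    also have "\<dots> = (\<Sum>c<d. \<Sum>r<d. A $$ (c, r) * x $ c * cnj (x $ r))"
      by (rule sum.swap)
    also have "\<dots> = (A *\<^sub>v y) \<bullet>c y"
      using A y by (simp add: form_eq_sum sum_distrib_right) (simp add: y_def mult_ac)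
    finally show ?thesis using assms y by (simp add: density_matrix_def)
  qed
  moreover have "mat_trace A\<^sup>T = mat_trace A"
    using A by (simp add: mat_trace_def)
  moreover have "mat_adjoint A\<^sup>T = A\<^sup>T"
    using assms adjoint_eq_iff[OF A] adjoint_eq_iff[of "A\<^sup>T" d] A by (simp add: density_matrix_def)
  ultimately show ?thesis using assms by (simp add: density_matrix_def)
qed

section \<open>Partial transposition of block matrices\<close>

text \<open>
  With \<open>w = n * q\<close>, the basis vector $e_i \otimes e_j \otimes e_k$ has block \<open>r div w\<close> \<open>= i - 1\<close>, and
  \<open>r mod w\<close> encodes \<open>(j, k)\<close>.
\<close>

definition swap_block :: "nat \<Rightarrow> nat \<Rightarrow> nat \<Rightarrow> nat" where
  "swap_block w r c = w * (c div w) + r mod w"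

text \<open>For \<open>w = n * q\<close> this is transposition on the first tensor factor: row and
  column exchange their block numbers and keep their positions inside the block.\<close>

definition partial_transpose :: "nat \<Rightarrow> 'a mat \<Rightarrow> 'a mat" where
  "partial_transpose w A =
     mat (dim_row A) (dim_col A) (\<lambda>(r, c). A $$ (swap_block w r c, swap_block w c r))"

lemma swap_block_self [simp]: "swap_block w r r = r"
  by (simp add: swap_block_def)

lemma swap_block_less:
  assumes "r < m * w" "c < m * w"
  shows "swap_block w r c < m * w"
proof -
  have w: "0 < w" using assms by (cases w) auto
  then have "c div w < m" using assms by (simp add: div_less_iff_less_mult)
  then have "w * (c div w) + w \<le> w * m"
    by (metis Suc_leI mult_Suc_right add.commute mult_le_mono2)
  moreover have "r mod w < w" using w by simp
  ultimately show ?thesis by (simp add: swap_block_def mult.commute)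
qed

text \<open>Diagonal positions correspond exactly to diagonal positions, so partial transposition
  fixes the degree matrix.\<close>

lemma swap_block_eq_iff:
  assumes "0 < w"
  shows "swap_block w r c = swap_block w c r \<longleftrightarrow> r = c"
proof
  assume "swap_block w r c = swap_block w c r"
  then have "swap_block w r c div w = swap_block w c r div w"
    "swap_block w r c mod w = swap_block w c r mod w" by simp_all
  then have "c div w = r div w" "r mod w = c mod w"
    using assms by (simp_all add: swap_block_def)
  then show "r = c" by (metis mult_div_mod_eq)
qed simp

section \<open>Threefold Kronecker products\<close>

text \<open>The three factors are indexed by the mixed-radix digits of \<open>r\<close> and
  \<open>c\<close>. The upper two are written relative to \<open>n * q\<close> to match the block
  decomposition in \<open>swap_block\<close>.\<close>

lemma kronecker3_index:
  assumes "A \<in> carrier_mat m m" "B \<in> carrier_mat n n" "C \<in> carrier_mat q q"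
    and "r < m * n * q" "c < m * n * q"
  shows "(A \<otimes>\<^sub>K B \<otimes>\<^sub>K C) $$ (r, c) =
    A $$ (r div (n * q), c div (n * q)) *
    B $$ (r mod (n * q) div q, c mod (n * q) div q) * C $$ (r mod q, c mod q)"
proof -
  have "r div q < m * n" "c div q < m * n"
    using assms(4,5) by (auto simp: less_mult_imp_div_less)
  \<comment> \<open>The left-nested product yields the middle digit in the form on the left.\<close>
  moreover have "x div q mod n = x mod (n * q) div q" for x
    by (cases "q = 0") (simp_all add: mult.commute[of n q] mod_mult2_eq)
  ultimately show ?thesis using assms
    by (simp add: kronecker_def div_mult2_eq[symmetric] mult.commute[of q n])
qed

text \<open>\<open>swap_block\<close> exchanges the leading digits of \<open>r\<close> and
  \<open>c\<close> and keeps the lower two, so only the arguments of \<open>A\<close> trade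
  places.\<close>

lemma kronecker3_partial_transpose:
  assumes "A \<in> carrier_mat m m" "B \<in> carrier_mat n n" "C \<in> carrier_mat q q"
    and r: "r < m * n * q" and c: "c < m * n * q"
  shows "(A \<otimes>\<^sub>K B \<otimes>\<^sub>K C) $$ (swap_block (n * q) r c, swap_block (n * q) c r)
    = (A\<^sup>T \<otimes>\<^sub>K B \<otimes>\<^sub>K C) $$ (r, c)"
proof -
  have w: "0 < n * q" using r by (cases "n * q = 0") auto
  have less: "swap_block (n * q) r c < m * n * q" "swap_block (n * q) c r < m * n * q"
    using swap_block_less[of r m "n * q" c] swap_block_less[of c m "n * q" r] r c
    by (simp_all add: mult.assoc)
  \<comment> \<open>As \<open>q\<close> divides \<open>n * q\<close>, the last digit depends only on
    the position inside the block.\<close>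
  have "x mod q = x mod (n * q) mod q" for x by (simp add: mod_mod_cancel)
  then have modq: "swap_block (n * q) x y mod q = x mod q" for x y
    by (metis mod_mod_trivial mod_mult_self4 swap_block_def)
  have "r div (n * q) < m" "c div (n * q) < m"
    using r c by (auto simp: less_mult_imp_div_less mult.assoc)
  then show ?thesis
    using assms less w
    by (simp add: kronecker3_index modq) (simp add: swap_block_def)
qed

section \<open>Signed Laplacians and the numbering of the vertices\<close>

text \<open>The sign \<open>s\<close> treats both claims at once: -1 gives the Laplacian, 1 the
  signless Laplacian.\<close>

definition signed_laplacian :: "complex \<Rightarrow> nat pair_pre_digraph \<Rightarrow> complex mat" where
  "signed_laplacian s G = degree_matrix G + s \<cdot>\<^sub>m adjacency_matrix G"

lemma laplacian_eq_signed: "laplacian G = signed_laplacian (-1) G"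
  by (auto simp: laplacian_def signed_laplacian_def degree_matrix_def adjacency_matrix_def)

lemma signless_laplacian_eq_signed: "signless_laplacian G = signed_laplacian 1 G"
  by (auto simp: signless_laplacian_def signed_laplacian_def degree_matrix_def adjacency_matrix_def)

lemma vertex_split:
  assumes r: "r < m * n * q"
  obtains i j k where "i \<in> {1..m}" "j \<in> {1..n}" "k \<in> {1..q}" "r + 1 = vertex n q i j k"
proof -
  have w: "0 < n * q" "0 < q" using r by (cases "n * q = 0"; auto)+
  have "r div (n * q) < m" using r by (auto simp: less_mult_imp_div_less mult.assoc)
  moreover have "r mod (n * q) div q < n" using w by (simp add: less_mult_imp_div_less)
  moreover have "r mod (n * q) mod q < q" using w by simp
  \<comment> \<open>The digits of \<open>r\<close>, each raised by 1, are the coordinates. The 1 in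
    \<open>r + 1\<close> goes into the last coordinate, the only one that \<open>vertex\<close> does
    not decrement.\<close>
  moreover have "r + 1 = vertex n q (r div (n * q) + 1) (r mod (n * q) div q + 1) (r mod (n * q) mod q + 1)"
    by (simp add: vertex_def)
  ultimately show ?thesis
    by (intro that[of "r div (n * q) + 1" "r mod (n * q) div q + 1" "r mod (n * q) mod q + 1"]) auto
qed

text \<open>Decoding a vertex is uniqueness of division with remainder: the part
  \<open>q * (j - 1) + (k - 1)\<close> is less than \<open>n * q\<close>, hence it is the remainder
  and \<open>i - 1\<close> the quotient.\<close>

lemma
  assumes "i \<in> {1..m}" "j \<in> {1..n}" "k \<in> {1..q}"
  shows vertex_ge: "1 \<le> vertex n q i j k"
    and vertex_div: "(vertex n q i j k - 1) div (n * q) = i - 1"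
    and vertex_mod: "(vertex n q i j k - 1) mod (n * q) = q * (j - 1) + (k - 1)"
    and vertex_le: "vertex n q i j k \<le> m * n * q"
proof -
  have eq: "vertex n q i j k - 1 = n * q * (i - 1) + (q * (j - 1) + (k - 1))"
    using assms by (auto simp: vertex_def)
  \<comment> \<open>A whole block of size \<open>a\<close> fits after the first \<open>b - 1\<close>
    of \<open>l\<close> blocks. This is used for the digits \<open>j\<close> and
    \<open>i\<close>.\<close>
  have block: "a * (b - 1) + a \<le> a * l" if "b \<in> {1..l}" for a b l :: nat
  proof -
    have "a * Suc (b - 1) \<le> a * l" using that by (intro mult_le_mono2) auto
    then show ?thesis unfolding mult_Suc_right by (rule ord_eq_le_trans[OF add.commute])
  qed
  have "q * (j - 1) + q \<le> q * n"
    using assms(2) by (rule block)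
  then have less: "q * (j - 1) + (k - 1) < n * q" using assms by (auto simp: mult.commute)
  show "1 \<le> vertex n q i j k" using assms by (simp add: vertex_def)
  show "(vertex n q i j k - 1) div (n * q) = i - 1"
    "(vertex n q i j k - 1) mod (n * q) = q * (j - 1) + (k - 1)"
    unfolding eq using less
    by (simp_all only: div_mult_self4[OF gr_implies_not0[OF less]] div_less mod_mult_self4 mod_less add_0_right)
  have "n * q * (i - 1) + n * q \<le> n * q * m"
    using assms(1) by (rule block)
  moreover have "n * q * m = m * n * q" by (simp only: mult.commute mult.left_commute)
  ultimately show "vertex n q i j k \<le> m * n * q"
    using eq less \<open>1 \<le> vertex n q i j k\<close> by linarith
qed

lemma tripartite_vertices_eq: "tripartite_vertices m n q = {1..m * n * q}"
proof (intro equalityI subsetI)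
  fix x assume "x \<in> {1..m * n * q}"
  then have "x - 1 < m * n * q" "x - 1 + 1 = x" by auto
  then obtain i j k where "i \<in> {1..m}" "j \<in> {1..n}" "k \<in> {1..q}" "x = vertex n q i j k"
    using vertex_split[of "x - 1" m n q] by metis
  then show "x \<in> tripartite_vertices m n q"
    unfolding tripartite_vertices_def by blast
next
  fix x assume "x \<in> tripartite_vertices m n q"
  then obtain i j k where "i \<in> {1..m}" "j \<in> {1..n}" "k \<in> {1..q}" "x = vertex n q i j k"
    unfolding tripartite_vertices_def by blast
  then show "x \<in> {1..m * n * q}"
    using vertex_ge[of i m j n k q] vertex_le[of i m j n k q] by simp
qed

text \<open>On vertices, \<open>swap_block\<close> is the GTPT move: the first coordinate comes from
  the other endpoint, the remaining two stay.\<close>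

lemma swap_block_vertex:
  assumes "i \<in> {1..m}" "j \<in> {1..n}" "k \<in> {1..q}" "s \<in> {1..m}" "u \<in> {1..n}" "v \<in> {1..q}"
  shows "swap_block (n * q) (vertex n q i j k - 1) (vertex n q s u v - 1) + 1 = vertex n q s j k"
  unfolding swap_block_def vertex_div[OF assms(4-6)] vertex_mod[OF assms(1-3)]
  using assms by (simp add: vertex_def)

section \<open>The GTPT as partial transposition\<close>

text \<open>One condition covers both kinds of edges: inside a block the swap is the identity, and
  between blocks it undoes the exchange of first coordinates.\<close>

lemma parcs_gtpt_iff:
  assumes r: "r < m * n * q" and c: "c < m * n * q"
  shows "(r + 1, c + 1) \<in> parcs (gtpt m n q G) \<longleftrightarrow>
    (swap_block (n * q) r c + 1, swap_block (n * q) c r + 1) \<in> parcs G"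
proof
  obtain i j k where ijk: "i \<in> {1..m}" "j \<in> {1..n}" "k \<in> {1..q}" "r + 1 = vertex n q i j k"
    using vertex_split[OF r] .
  obtain s u v where suv: "s \<in> {1..m}" "u \<in> {1..n}" "v \<in> {1..q}" "c + 1 = vertex n q s u v"
    using vertex_split[OF c] .
  have w: "0 < n * q" using r by (cases "n * q = 0") auto
  have rc: "r = vertex n q i j k - 1" "c = vertex n q s u v - 1"
    using ijk(4) suv(4) by simp_all
  have sw: "swap_block (n * q) r c + 1 = vertex n q s j k"
    "swap_block (n * q) c r + 1 = vertex n q i u v"
    unfolding rc using swap_block_vertex ijk suv by blast+
  {
    assume "(swap_block (n * q) r c + 1, swap_block (n * q) c r + 1) \<in> parcs G"
    then have "(vertex n q s j k, vertex n q i u v) \<in> parcs G" by (simp only: sw)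
    \<comment> \<open>For \<open>i = s\<close> the arc lies in the first set of \<open>gtpt\<close>;
      otherwise it lies in the second, with the roles of \<open>i\<close> and \<open>s\<close>
      exchanged.\<close>
    then show "(r + 1, c + 1) \<in> parcs (gtpt m n q G)"
      unfolding ijk(4) suv(4) gtpt_def using ijk(1-3) suv(1-3)
      by (cases "i = s") (simp, blast)+
  }
  assume "(r + 1, c + 1) \<in> parcs (gtpt m n q G)"
  then consider
      (same) i j k u v where "i \<in> {1..m}" "j \<in> {1..n}" "k \<in> {1..q}" "u \<in> {1..n}" "v \<in> {1..q}"
        "r + 1 = vertex n q i j k" "c + 1 = vertex n q i u v" "(r + 1, c + 1) \<in> parcs G"
    | (cross) i j k s u v where "i \<in> {1..m}" "j \<in> {1..n}" "k \<in> {1..q}" "s \<in> {1..m}" "u \<in> {1..n}" "v \<in> {1..q}"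
        "r + 1 = vertex n q s j k" "c + 1 = vertex n q i u v"
        "(vertex n q i j k, vertex n q s u v) \<in> parcs G"
    unfolding gtpt_def by auto
  then show "(swap_block (n * q) r c + 1, swap_block (n * q) c r + 1) \<in> parcs G"
  proof cases
    case same
    then have "r = vertex n q i j k - 1" "c = vertex n q i u v - 1" by simp_all
    then have "swap_block (n * q) r c + 1 = r + 1" "swap_block (n * q) c r + 1 = c + 1"
      using same swap_block_vertex by metis+
    then show ?thesis using same by simp
  next
    case cross
    then have "r = vertex n q s j k - 1" "c = vertex n q i u v - 1" by simp_all
    then have "swap_block (n * q) r c + 1 = vertex n q i j k"
      "swap_block (n * q) c r + 1 = vertex n q s u v"
      using cross swap_block_vertex by metis+
    then show ?thesis using cross by simp
  qed
qed

text \<open>Off the diagonal this is \<open>parcs_gtpt_iff\<close>; on the diagonal the degrees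
  agree by degree symmetry.\<close>

lemma signed_laplacian_gtpt:
  assumes verts: "pverts G = tripartite_vertices m n q" and deg: "degree_symmetric m n q G"
  shows "signed_laplacian s (gtpt m n q G) = partial_transpose (n * q) (signed_laplacian s G)"
proof -
  have card: "card (pverts G) = m * n * q" "pverts (gtpt m n q G) = pverts G"
    by (simp_all add: verts tripartite_vertices_eq gtpt_def)
  have degs: "degree_of (gtpt m n q G) (Suc r) = degree_of G (Suc r)" if "r < m * n * q" for r
    using deg that by (auto simp: degree_symmetric_def verts tripartite_vertices_eq)
  show ?thesis
  proof (rule eq_matI)
    fix r c assume "r < dim_row (partial_transpose (n * q) (signed_laplacian s G))"
      "c < dim_col (partial_transpose (n * q) (signed_laplacian s G))"
    then have rc: "r < m * n * q" "c < m * n * q"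
      by (simp_all add: partial_transpose_def signed_laplacian_def adjacency_matrix_def card)
    then have w: "0 < n * q" by (cases "n * q = 0") auto
    have "swap_block (n * q) r c < m * n * q" "swap_block (n * q) c r < m * n * q"
      using swap_block_less[of r m "n * q" c] swap_block_less[of c m "n * q" r] rc
      by (simp_all add: mult.assoc)
    then show "signed_laplacian s (gtpt m n q G) $$ (r, c) =
      partial_transpose (n * q) (signed_laplacian s G) $$ (r, c)"
      using rc parcs_gtpt_iff[OF rc, of G] degs[OF rc(1)] swap_block_eq_iff[OF w, of r c]
      by (auto simp: partial_transpose_def signed_laplacian_def adjacency_matrix_def
          degree_matrix_def card)
  qed (simp_all add: partial_transpose_def signed_laplacian_def adjacency_matrix_def card)
qed

section \<open>Positivity of the signed Laplacian and symmetry of the GTPT\<close>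

lemma out_degree_eq_card:
  "out_degree (with_proj G) u = card {v. (u, v) \<in> parcs G}"
proof -
  have "out_arcs (with_proj G) u = Pair u ` {v. (u, v) \<in> parcs G}"
    by (auto simp: out_arcs_def)
  then show ?thesis by (simp add: out_degree_def card_image inj_on_def)
qed

text \<open>Degrees are row sums of the adjacency matrix, so the form is the one in
  \<open>signed_quadratic_form_nonneg\<close>. The assumptions concern the arc relation itself, so
  that they can be checked directly for the GTPT.\<close>

lemma signed_laplacian_psd:
  assumes verts: "pverts G = {1..N}" and arcs: "parcs G \<subseteq> {1..N} \<times> {1..N}"
    and sym: "sym (parcs G)" and s: "s = 1 \<or> s = -1" and x: "x \<in> carrier_vec N"
  shows "0 \<le> (signed_laplacian s G *\<^sub>v x) \<bullet>c x"
proof -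
  define a :: "nat \<Rightarrow> nat \<Rightarrow> complex" where "a r c = of_bool ((r + 1, c + 1) \<in> parcs G)" for r c
  have deg: "of_nat (degree_of G (r + 1)) = (\<Sum>c<N. a r c)" for r
  proof -
    \<comment> \<open>\<open>Suc\<close> passes from column indices to vertices; since arcs end in
      \<open>{1..N}\<close>, no neighbour is missed.\<close>
    have "{v. (r + 1, v) \<in> parcs G} = Suc ` {c \<in> {..<N}. (r + 1, c + 1) \<in> parcs G}"
    proof (intro equalityI subsetI)
      fix v assume v: "v \<in> {v. (r + 1, v) \<in> parcs G}"
      then have "v \<in> {1..N}" using arcs by auto
      then show "v \<in> Suc ` {c \<in> {..<N}. (r + 1, c + 1) \<in> parcs G}"
        using v by (intro image_eqI[of _ _ "v - 1"]) auto
    qed auto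
    then show ?thesis
      by (simp add: out_degree_eq_card card_image a_def sum.If_cases of_bool_def Int_def)
  qed
  have entry: "signed_laplacian s G $$ (r, c) = (if r = c then \<Sum>c<N. a r c else 0) + s * a r c"
    if "r < N" "c < N" for r c
    using that deg[of r]
    by (auto simp: signed_laplacian_def degree_matrix_def adjacency_matrix_def verts a_def)
  have carr: "signed_laplacian s G \<in> carrier_mat N N"
    by (simp add: signed_laplacian_def adjacency_matrix_def degree_matrix_def verts)
  have "(signed_laplacian s G *\<^sub>v x) \<bullet>c x =
    (\<Sum>r<N. (\<Sum>c<N. ((if r = c then \<Sum>c<N. a r c else 0) + s * a r c) * x $ c) * cnj (x $ r))"
    using entry by (simp add: form_eq_sum[OF carr x])
  also have "\<dots> = (\<Sum>r<N. ((\<Sum>c<N. a r c) * x $ r + s * (\<Sum>c<N. a r c * x $ c)) * cnj (x $ r))"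
    by (intro sum.cong refl)
      (simp add: distrib_right sum.distrib if_distrib[of "\<lambda>t. t * _"] sum_distrib_left mult.assoc
        cong: if_cong)
  also have "\<dots> = (\<Sum>r<N. (\<Sum>c<N. a r c) * x $ r * cnj (x $ r)) +
      s * (\<Sum>r<N. \<Sum>c<N. a r c * x $ c * cnj (x $ r))"
    by (simp add: distrib_right sum.distrib sum_distrib_left sum_distrib_right mult.assoc)
  also have "0 \<le> \<dots>"
    using sym s by (intro signed_quadratic_form_nonneg) (auto simp: a_def sym_def less_eq_complex_def)
  finally show ?thesis .
qed

text \<open>Exchanging \<open>r\<close> and \<open>c\<close> in \<open>parcs_gtpt_iff\<close>
  reverses the corresponding arc of \<open>G\<close>.\<close>

lemma sym_parcs_gtpt:
  assumes "sym (parcs G)"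
  shows "sym (parcs (gtpt m n q G))"
proof (rule symI)
  fix x y assume "(x, y) \<in> parcs (gtpt m n q G)"
  moreover from this have "x \<in> {1..m * n * q}" "y \<in> {1..m * n * q}"
    unfolding tripartite_vertices_eq[symmetric] gtpt_def tripartite_vertices_def by auto
  moreover from this obtain r c where "x = r + 1" "y = c + 1" "r < m * n * q" "c < m * n * q"
    by (metis Suc_eq_plus1 Suc_le_lessD atLeastAtMost_iff le_add_diff_inverse2)
  ultimately show "(y, x) \<in> parcs (gtpt m n q G)"
    using parcs_gtpt_iff symD[OF assms] by blast
qed

section \<open>Separability under partial transposition\<close>

lemma mat_trace_partial_transpose:
  assumes "A \<in> carrier_mat d d"
  shows "mat_trace (partial_transpose w A) = mat_trace A"
  using assms by (auto simp: mat_trace_def partial_transpose_def)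

lemma mat_trace_smult:
  fixes A :: "complex mat"
  assumes "A \<in> carrier_mat d d"
  shows "mat_trace (k \<cdot>\<^sub>m A) = k * mat_trace A"
  using assms by (simp add: mat_trace_def sum_distrib_left)

lemma partial_transpose_smult:
  assumes "A \<in> carrier_mat (m * w) (m * w)"
  shows "partial_transpose w (k \<cdot>\<^sub>m A) = k \<cdot>\<^sub>m partial_transpose w A"
  using assms by (auto simp: partial_transpose_def swap_block_less intro!: eq_matI)

text \<open>Partial transposition acts termwise on the convex combination: the weights and the last
  two factors stay, and each first factor becomes its transpose, again a density matrix. Positivity
  of the whole enters as \<open>psd\<close>.\<close>

lemma fully_separable_partial_transpose:
  assumes sep: "fully_separable m n q \<rho>"
    and psd: "\<And>x. x \<in> carrier_vec (m * n * q) \<Longrightarrow> 0 \<le> (partial_transpose (n * q) \<rho> *\<^sub>v x) \<bullet>c x"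
  shows "fully_separable m n q (partial_transpose (n * q) \<rho>)"
proof -
  let ?N = "m * n * q"
  obtain K and p :: "nat \<Rightarrow> real" and \<rho>1 \<rho>2 \<rho>3 where
    dens: "\<forall>i<K. 0 \<le> p i \<and> density_matrix m (\<rho>1 i) \<and> density_matrix n (\<rho>2 i) \<and> density_matrix q (\<rho>3 i)"
    and p: "(\<Sum>i<K. p i) = 1"
    and \<rho>: "\<rho> = mat ?N ?N (\<lambda>rc. \<Sum>i<K. complex_of_real (p i) * (\<rho>1 i \<otimes>\<^sub>K \<rho>2 i \<otimes>\<^sub>K \<rho>3 i) $$ rc)"
    using sep unfolding fully_separable_def by blast
  have d: "density_matrix ?N \<rho>" using sep by (simp add: fully_separable_def)
  then have carr: "\<rho> \<in> carrier_mat ?N ?N" by (simp add: density_matrix_def)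
  have carr': "partial_transpose (n * q) \<rho> \<in> carrier_mat ?N ?N"
    using carr by (simp add: partial_transpose_def)
  have less: "swap_block (n * q) r c < ?N" if "r < ?N" "c < ?N" for r c
    using swap_block_less[of r m "n * q" c] that by (simp add: mult.assoc)
  \<comment> \<open>Exchanging \<open>r\<close> and \<open>c\<close> exchanges the two swapped
    indices, so the Hermitian condition is inherited entrywise.\<close>
  have "mat_adjoint (partial_transpose (n * q) \<rho>) = partial_transpose (n * q) \<rho>"
    using d carr less adjoint_eq_iff[OF carr]
    by (simp add: adjoint_eq_iff[OF carr'] density_matrix_def) (simp add: partial_transpose_def)
  then have dens_pt: "density_matrix ?N (partial_transpose (n * q) \<rho>)"
    using d carr' psd by (simp add: density_matrix_def mat_trace_partial_transpose[OF carr])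
  have eq_pt: "partial_transpose (n * q) \<rho> =
    mat ?N ?N (\<lambda>rc. \<Sum>i<K. complex_of_real (p i) * ((\<rho>1 i)\<^sup>T \<otimes>\<^sub>K \<rho>2 i \<otimes>\<^sub>K \<rho>3 i) $$ rc)"
  proof (rule eq_matI; simp add: partial_transpose_def \<rho> less)
    fix r c assume "r < ?N" "c < ?N"
    then show "(\<Sum>i<K. complex_of_real (p i) *
        (\<rho>1 i \<otimes>\<^sub>K \<rho>2 i \<otimes>\<^sub>K \<rho>3 i) $$ (swap_block (n * q) r c, swap_block (n * q) c r)) =
      (\<Sum>i<K. complex_of_real (p i) * ((\<rho>1 i)\<^sup>T \<otimes>\<^sub>K \<rho>2 i \<otimes>\<^sub>K \<rho>3 i) $$ (r, c))"
      using dens by (intro sum.cong refl arg_cong2[where f = "(*)"] kronecker3_partial_transpose)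
        (auto simp: density_matrix_def)
  qed
  have factors: "\<forall>i<K. 0 \<le> p i \<and> density_matrix m (\<rho>1 i)\<^sup>T \<and> density_matrix n (\<rho>2 i) \<and>
      density_matrix q (\<rho>3 i)"
    using dens density_matrix_transpose by blast
  show ?thesis
    unfolding fully_separable_def
    by (rule conjI[OF dens_pt], rule exI[of _ K], rule exI[of _ p],
        rule exI[of _ "\<lambda>i. (\<rho>1 i)\<^sup>T"], rule exI[of _ \<rho>2], rule exI[of _ \<rho>3],
        rule conjI[OF factors conjI[OF p eq_pt]])
qed

text \<open>Partial transposition fixes the diagonal and hence the trace, so it commutes with
  normalisation and carries the density matrix of \<open>G\<close> to that of its GTPT.\<close>

lemma fully_separable_gtpt:
  fixes s :: complex
  defines "\<rho> \<equiv> \<lambda>G. (1 / mat_trace (signed_laplacian s G)) \<cdot>\<^sub>m signed_laplacian s G"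
  assumes G: "pair_graph G" and verts: "pverts G = tripartite_vertices m n q"
    and deg: "degree_symmetric m n q G" and s: "s = 1 \<or> s = -1"
    and sep: "fully_separable m n q (\<rho> G)"
  shows "fully_separable m n q (\<rho> (gtpt m n q G))"
proof -
  interpret pair_graph G by fact
  let ?N = "m * n * q" and ?L = "signed_laplacian s"
  have carr: "?L G \<in> carrier_mat ?N ?N" "?L (gtpt m n q G) \<in> carrier_mat ?N ?N"
    by (simp_all add: signed_laplacian_def adjacency_matrix_def degree_matrix_def verts
        tripartite_vertices_eq gtpt_def)
  have tr: "mat_trace (?L (gtpt m n q G)) = mat_trace (?L G)"
    by (simp add: signed_laplacian_gtpt[OF verts deg] mat_trace_partial_transpose[OF carr(1)])
  have eq: "\<rho> (gtpt m n q G) = partial_transpose (n * q) (\<rho> G)"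
    using carr(1) partial_transpose_smult[of "?L G" m "n * q"]
    by (simp add: \<rho>_def tr) (simp add: signed_laplacian_gtpt[OF verts deg] mult.assoc)
  \<comment> \<open>Without loops the adjacency matrix has zero diagonal, so the trace is a sum of
    degrees and thus a nonnegative real. Its inverse is nonnegative too, with
    \<open>1 / 0 = 0\<close>.\<close>
  have loopless: "(u, u) \<notin> parcs G" for u using no_loops by fastforce
  have "mat_trace (?L G) = (\<Sum>r<?N. of_nat (degree_of G (r + 1)))"
    by (simp add: mat_trace_def signed_laplacian_def adjacency_matrix_def degree_matrix_def verts
        tripartite_vertices_eq loopless)
  then have tr_nonneg: "0 \<le> 1 / mat_trace (?L G)"
    by (simp add: less_eq_complex_def flip: of_nat_sum)
  have symG: "sym (parcs G)" using sym_arcs by (simp add: symmetric_def)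
  have "0 \<le> (\<rho> (gtpt m n q G) *\<^sub>v x) \<bullet>c x" if x: "x \<in> carrier_vec ?N" for x
  proof -
    have "parcs (gtpt m n q G) \<subseteq> {1..?N} \<times> {1..?N}"
      unfolding tripartite_vertices_eq[symmetric] gtpt_def tripartite_vertices_def by auto
    then have "0 \<le> (?L (gtpt m n q G) *\<^sub>v x) \<bullet>c x"
      using sym_parcs_gtpt[OF symG] s x
      by (intro signed_laplacian_psd[where N = ?N])
        (simp_all add: gtpt_def verts tripartite_vertices_eq)
    moreover have "(\<rho> (gtpt m n q G) *\<^sub>v x) \<bullet>c x =
        (1 / mat_trace (?L G)) * ((?L (gtpt m n q G) *\<^sub>v x) \<bullet>c x)"
      unfolding \<rho>_def tr by (rule form_smult[OF carr(2) x])
    ultimately show ?thesis using tr_nonneg by (metis mult_nonneg_nonneg)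
  qed
  then show ?thesis
    using sep unfolding eq by (intro fully_separable_partial_transpose) auto
qed

theorem theorem1:
  fixes m n q :: nat and G :: "nat pair_pre_digraph"
  assumes "m \<ge> 1" and "n \<ge> 1" and "q \<ge> 1"
    and "pair_graph G"
    and "pverts G = tripartite_vertices m n q"
    and "parcs G \<noteq> {}"
    and "degree_symmetric m n q G"
  shows "(fully_separable m n q (rho_l G) \<longrightarrow> fully_separable m n q (rho_l (gtpt m n q G))) \<and>
         (fully_separable m n q (rho_q G) \<longrightarrow> fully_separable m n q (rho_q (gtpt m n q G)))"
  using fully_separable_gtpt[of G m n q "-1"] fully_separable_gtpt[of G m n q 1] assms
  by (simp add: rho_l_def rho_q_def laplacian_eq_signed signless_laplacian_eq_signed)

end
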